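(* Let $\mathcal{P}$ be a basic cell of a lattice $\mathbf{G}\mathbb{Z}^n$ ($\mathbf{G}\in\mathbb{R}^{n\times n}$ full-rank), let $f:\mathbb{R}^n\to[0,\infty)$ be a probability density function such that $L_t^+(f)$ is bounded for every $t>0$, let $\beta:(0,\infty)\to[0,\infty)$ satisfy $L_t^+(f)\subseteq\beta(t)\mathcal{P}$ for every $t>0$, and consider the layered rejection-sampled universal quantizer (LRSUQ) $Q_{f,\mathcal{P}}$ for $f$ against $\mathcal{P}$, with state $S=(T,(\mathbf{V}_i)_i)$. For any random input $\mathbf{X}\in\mathbb{R}^n$ independent of $S$, the quantization error $\mathbf{Z}:=Q_{f,\mathcal{P}}(\mathbf{X},T,(\mathbf{V}_i)_i)-\mathbf{X}$ follows the probability density function $f$, and is independent of $\mathbf{X}$.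
   Context: $\mu$ is Lebesgue measure on $\mathbb{R}^n$; sets and functions are measurable. For $f:\mathbb{R}^n\to[0,\infty)$ the superlevel set is $L_t^+(f):=\{\mathbf{z}\in\mathbb{R}^n:f(\mathbf{z})\ge t\}$. A bounded set $\mathcal{P}\subseteq\mathbb{R}^n$ is a basic cell of $\mathbf{G}\mathbb{Z}^n$ if the translates $(\mathcal{P}+\mathbf{G}\mathbf{j})_{\mathbf{j}\in\mathbb{Z}^n}$ partition $\mathbb{R}^n$. For a basic cell $\mathcal{P}$, $Q_{\mathcal{P}}(\mathbf{x})$ is the unique lattice point $\mathbf{y}\in\mathbf{G}\mathbb{Z}^n$ with $\mathbf{x}\in-\mathcal{P}+\mathbf{y}$. LRSUQ for $f$ against $\mathcal{P}$ (with $f,\beta$ as in the claim): the state is $S=(T,(\mathbf{V}_i)_{i\ge1})$, where $T$ has probability density function $f_T(t):=\mu(L_t^+(f))$ on $(0,\infty)$, and $\mathbf{V}_1,\mathbf{V}_2,\ldots$ are i.i.d. $\mathrm{Unif}(\mathcal{P})$, independent of $T$. The quantization function is \[ Q_{f,\mathcal{P}}(\mathbf{x},t,(\mathbf{v}_i)_i):=\beta(t)\cdot\big(Q_{\mathcal{P}}(\mathbf{x}/\beta(t)-\mathbf{v}_k)+\mathbf{v}_k\big),\qquad k:=\min\big\{i:\beta(t)\cdot\big(Q_{\mathcal{P}}(\mathbf{x}/\beta(t)-\mathbf{v}_i)+\mathbf{v}_i\big)-\mathbf{x}\in L_t^+(f)\big\}. \] ($\beta(T)>0$ almost surely, and $k$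 exists almost surely for each fixed $\mathbf{x}$.) *)

theory Defs
  imports "HOL-Probability.Probability"
begin

definition lattice_point :: "real ^ 'n ^ 'n \<Rightarrow> int ^ 'n \<Rightarrow> real ^ 'n" where
  "lattice_point G j = G *v (\<chi> i. real_of_int (j $ i))"

definition basic_cell :: "real ^ 'n ^ 'n \<Rightarrow> (real ^ 'n) set \<Rightarrow> bool" where
  "basic_cell G P \<longleftrightarrow>
     bounded P \<and>
     disjoint_family (\<lambda>j. (\<lambda>p. p + lattice_point G j) ` P) \<and>
     (\<Union>j. (\<lambda>p. p + lattice_point G j) ` P) = UNIV"

definition cell_quantizer :: "real ^ 'n ^ 'n \<Rightarrow> (real ^ 'n) set \<Rightarrow> real ^ 'n \<Rightarrow> real ^ 'n" where
  "cell_quantizer G P x = (THE y. y \<in> range (lattice_point G) \<and> x \<in> (\<lambda>p. - p + y) ` P)"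

definition superlevel :: "('a \<Rightarrow> real) \<Rightarrow> real \<Rightarrow> 'a set" where
  "superlevel f t = {z. f z \<ge> t}"

definition dithered_quantizer ::
    "real ^ 'n ^ 'n \<Rightarrow> (real ^ 'n) set \<Rightarrow> real \<Rightarrow> real ^ 'n \<Rightarrow> real ^ 'n \<Rightarrow> real ^ 'n" where
  "dithered_quantizer G P b x v = b *\<^sub>R (cell_quantizer G P (x /\<^sub>R b - v) + v)"

text \<open>The dither sequence is indexed from 0. If no index is accepted (a null event),
  \<open>LEAST\<close> returns some fixed, unspecified number.\<close>

definition lrsuq_index ::
    "real ^ 'n ^ 'n \<Rightarrow> (real ^ 'n) set \<Rightarrow> (real ^ 'n \<Rightarrow> real) \<Rightarrow> (real \<Rightarrow> real) \<Rightarrow>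
     real ^ 'n \<Rightarrow> real \<Rightarrow> (nat \<Rightarrow> real ^ 'n) \<Rightarrow> nat" where
  "lrsuq_index G P f \<beta> x t v =
     (LEAST i. dithered_quantizer G P (\<beta> t) x (v i) - x \<in> superlevel f t)"

definition lrsuq ::
    "real ^ 'n ^ 'n \<Rightarrow> (real ^ 'n) set \<Rightarrow> (real ^ 'n \<Rightarrow> real) \<Rightarrow> (real \<Rightarrow> real) \<Rightarrow>
     real ^ 'n \<Rightarrow> real \<Rightarrow> (nat \<Rightarrow> real ^ 'n) \<Rightarrow> real ^ 'n" where
  "lrsuq G P f \<beta> x t v = dithered_quantizer G P (\<beta> t) x (v (lrsuq_index G P f \<beta> x t v))"

text \<open>The library's \<open>indep_var\<close> forces both random variables to have the same codomain type;
  the following is its heterogeneous version.\<close>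

definition indep_rv ::
    "'w measure \<Rightarrow> 'a measure \<Rightarrow> ('w \<Rightarrow> 'a) \<Rightarrow> 'b measure \<Rightarrow> ('w \<Rightarrow> 'b) \<Rightarrow> bool" where
  "indep_rv M A X B Y \<longleftrightarrow>
     X \<in> measurable M A \<and> Y \<in> measurable M B \<and>
     prob_space.indep_set M {X -` E \<inter> space M | E. E \<in> sets A} {Y -` E \<inter> space M | E. E \<in> sets B}"

lemma indep_rv_iff_indep_var:
  assumes "prob_space M"
  shows "indep_rv M A X B Y \<longleftrightarrow> prob_space.indep_var M A X B Y"
proof -
  interpret prob_space M by fact
  have s: "sigma_sets (space M) {Z -` E \<inter> space M | E. E \<in> sets C} =
           {Z -` E \<inter> space M | E. E \<in> sets C}"
    if "Z \<in> measurable M C" for Z and C :: "'b measure"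
  proof -
    have "{Z -` E \<inter> space M | E. E \<in> sets C} = sets (vimage_algebra (space M) Z C)"
      using measurable_space[OF that] by (subst sets_vimage_algebra2) auto
    then show ?thesis
      using sets.sigma_sets_eq[of "vimage_algebra (space M) Z C"] by simp
  qed
  show ?thesis
    unfolding indep_rv_def indep_var_eq using s by auto
qed

text \<open>\<open>T\<close> takes its values in \<open>(0,\<infinity>)\<close>, the domain of \<open>\<beta>\<close>.\<close>

definition lrsuq_state ::
    "'w measure \<Rightarrow> (real ^ 'n) set \<Rightarrow> (real ^ 'n \<Rightarrow> real) \<Rightarrow>
     ('w \<Rightarrow> real) \<Rightarrow> (nat \<Rightarrow> 'w \<Rightarrow> real ^ 'n) \<Rightarrow> bool" where
  "lrsuq_state M P f T V \<longleftrightarrow>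
     distributed M (restrict_space lborel {0<..}) T (\<lambda>t. emeasure lborel (superlevel f t)) \<and>
     prob_space.indep_vars M (\<lambda>_. borel) V UNIV \<and>
     (\<forall>i. distr M lborel (V i) = uniform_measure lborel P) \<and>
     indep_rv M borel T (PiM UNIV (\<lambda>_. borel)) (\<lambda>\<omega> i. V i \<omega>)"

end

theory Submission
  imports Defs
begin

text \<open>
  Fix the input \<open>x\<close> and the layer \<open>t\<close>. Modulo the lattice, the scaled error of a dithered quantizer
  is a translate of the dither, so cutting \<open>P\<close> along the lattice translates and reassembling the
  pieces shows that the error is uniform on \<open>\<beta> t *\<^sub>R P\<close>. Rejection sampling turns it into the uniform
  distribution on \<open>superlevel f t\<close>. The density of \<open>T\<close> is exactly the normalising constant of that
  distribution, so averaging over \<open>t\<close> leaves the layer-cake integral of \<open>f\<close>, whatever \<open>x\<close> was.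
\<close>

section \<open>Rejection sampling from an i.i.d. sequence\<close>

text \<open>
  Splitting off the first sample gives the recursion \<open>e = M B + (1 - M A) * e\<close>. Because of
  \<open>B \<subseteq> A\<close>, the unspecified value of \<open>LEAST\<close> on a sequence that is never accepted does not matter.
\<close>

lemma (in sequence_space) emeasure_first_accepted_subset:
  assumes A [measurable]: "A \<in> sets M" and B [measurable]: "B \<in> sets M" and sub: "B \<subseteq> A"
  shows "emeasure S {\<omega> \<in> space S. \<omega> (LEAST i. \<omega> i \<in> A) \<in> B} * emeasure M A = emeasure M B"
proof -
  define E where "E = {\<omega> \<in> space S. \<omega> (LEAST i. \<omega> i \<in> A) \<in> B}"
  have E [measurable]: "E \<in> sets S"
  proof -
    have "(\<lambda>\<omega>. \<omega> (LEAST i. \<omega> i \<in> A)) \<in> measurable S M"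
      by (rule measurable_compose_countable[where f = "\<lambda>i \<omega>. \<omega> i"]) measurable
    then show ?thesis
      unfolding E_def by measurable
  qed
  \<comment> \<open>Prepending a sample either settles the event at index 0 or moves the first
    accepted index up by one without changing the accepted value.\<close>
  have shift: "case_nat s \<omega> \<in> E \<longleftrightarrow> (if s \<in> A then s \<in> B else \<omega> \<in> E)"
    if s: "s \<in> space M" and \<omega>: "\<omega> \<in> space S" for s \<omega>
  proof -
    have sp: "case_nat s \<omega> \<in> space S"
      using s \<omega> by (auto simp: space_PiM PiE_iff split: nat.split)
    show ?thesis
    proof (cases "s \<in> A")
      case True
      then have "(LEAST i. case_nat s \<omega> i \<in> A) = 0"
        by (intro Least_eq_0) simp
      with True sp show ?thesis by (simp add: E_def)
    next
      case F: False
      show ?thesis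
      proof (cases "\<exists>i. \<omega> i \<in> A")
        case True
        then obtain i where "\<omega> i \<in> A" ..
        then have "(LEAST i. case_nat s \<omega> i \<in> A) = Suc (LEAST i. \<omega> i \<in> A)"
          using F by (subst Least_Suc[of _ "Suc i"]) auto
        with F sp \<omega> show ?thesis by (simp add: E_def)
      next
        case False
        \<comment> \<open>Here both \<open>LEAST\<close> terms are unspecified, but no entry of
          either sequence lies in \<open>A\<close>, hence none in \<open>B\<close>, so neither
          sequence belongs to \<open>E\<close>.\<close>
        then have "case_nat s \<omega> i \<notin> A" "\<omega> i \<notin> A" for i
          using F by (auto split: nat.split)
        then have "case_nat s \<omega> i \<notin> B" "\<omega> i \<notin> B" for i
          using sub by blast+
        with F show ?thesis by (simp add: E_def)
      qed
    qed
  qed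
  \<comment> \<open>\<open>PiM_iter\<close>: prepending an independent sample to an i.i.d. sequence
    reproduces the product measure. This is what makes the recursion close up.\<close>
  have "emeasure S E = emeasure (distr (M \<Otimes>\<^sub>M S) S (\<lambda>(s, \<omega>). case_nat s \<omega>)) E"
    by (simp add: PiM_iter)
  also have "\<dots> = (\<integral>\<^sup>+s. emeasure S (Pair s -` ((\<lambda>(s, \<omega>). case_nat s \<omega>) -` E \<inter> space (M \<Otimes>\<^sub>M S))) \<partial>M)"
    by (subst emeasure_distr) (measurable, rule P.emeasure_pair_measure_alt, measurable)
  also have "\<dots> = (\<integral>\<^sup>+s. indicator B s + emeasure S E * indicator (space M - A) s \<partial>M)"
  proof (rule nn_integral_cong)
    fix s assume s: "s \<in> space M"
    have "Pair s -` ((\<lambda>(s, \<omega>). case_nat s \<omega>) -` E \<inter> space (M \<Otimes>\<^sub>M S)) =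
            {\<omega> \<in> space S. if s \<in> A then s \<in> B else \<omega> \<in> E}"
      using s shift[OF s] by (auto simp: space_pair_measure)
    also have "emeasure S \<dots> = indicator B s + emeasure S E * indicator (space M - A) s"
    proof (cases "s \<in> A")
      case True
      then show ?thesis by (auto simp: P.emeasure_space_1 split: split_indicator)
    next
      case False
      moreover have "{\<omega> \<in> space S. \<omega> \<in> E} = E"
        by (auto simp: E_def)
      moreover have "s \<notin> B" using False sub by blast
      ultimately show ?thesis using s by simp
    qed
    finally show "emeasure S (Pair s -` ((\<lambda>(s, \<omega>). case_nat s \<omega>) -` E \<inter> space (M \<Otimes>\<^sub>M S))) =
      indicator B s + emeasure S E * indicator (space M - A) s" .
  qed
  also have "\<dots> = emeasure M B + emeasure S E * emeasure M (space M - A)"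
    by (subst nn_integral_add) (auto simp: nn_integral_cmult)
  finally have "emeasure S E = emeasure M B + emeasure S E * emeasure M (space M - A)" .
  \<comment> \<open>The recursion is solved over the reals, where \<open>P.prob E\<close> can be
    cancelled from both sides.\<close>
  then have "P.prob E = M.prob B + P.prob E * (1 - M.prob A)"
    by (simp add: P.emeasure_eq_measure M.emeasure_eq_measure M.prob_compl
        flip: ennreal_mult ennreal_plus)
  then have "P.prob E * M.prob A = M.prob B"
    by (simp add: algebra_simps)
  then show ?thesis
    unfolding E_def[symmetric]
    by (simp add: P.emeasure_eq_measure M.emeasure_eq_measure flip: ennreal_mult)
qed

lemma (in sequence_space) emeasure_first_accepted:
  assumes A [measurable]: "A \<in> sets M" and B [measurable]: "B \<in> sets M" and pos: "emeasure M A \<noteq> 0"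
  shows "emeasure S {\<omega> \<in> space S. \<omega> (LEAST i. \<omega> i \<in> A) \<in> B} * emeasure M A = emeasure M (A \<inter> B)"
proof -
  let ?F = "\<lambda>\<omega>. \<omega> (LEAST i. \<omega> i \<in> A)"
  have F [measurable]: "?F \<in> measurable S M"
    by (rule measurable_compose_countable[where f = "\<lambda>i \<omega>. \<omega> i"]) measurable
  have "P.prob {\<omega> \<in> space S. ?F \<omega> \<in> A} = 1"
    using emeasure_first_accepted_subset[OF A A] pos
    by (simp add: P.emeasure_eq_measure M.emeasure_eq_measure flip: ennreal_mult)
  then have "AE \<omega> in S. ?F \<omega> \<in> A"
    by (subst (asm) P.prob_Collect_eq_1) auto
  then have "emeasure S {\<omega> \<in> space S. ?F \<omega> \<in> B} = emeasure S {\<omega> \<in> space S. ?F \<omega> \<in> A \<inter> B}"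
    by (intro emeasure_eq_AE) auto
  then show ?thesis
    using emeasure_first_accepted_subset[of A "A \<inter> B"] by simp
qed

section \<open>Lattice translates and the cell quantizer\<close>

lemma lattice_point_minus: "lattice_point G (- j) = - lattice_point G j"
proof -
  have "(\<chi> i. real_of_int ((- j) $ i)) = - (\<chi> i. real_of_int (j $ i))"
    by (simp add: vec_eq_iff)
  then show ?thesis
    unfolding lattice_point_def by (metis matrix_vector_mul_linear linear_neg)
qed

text \<open>Covering gives existence and disjointness gives uniqueness. What is unique is the
  integer index, since the translates are disjoint as an indexed family.\<close>

lemma basic_cell_ex1:
  assumes "basic_cell G P"
  shows "\<exists>!j. x - lattice_point G j \<in> P"
proof -
  have *: "x \<in> (\<lambda>p. p + lattice_point G j) ` P \<longleftrightarrow> x - lattice_point G j \<in> P" for j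
    by (auto simp: image_iff) (metis diff_add_cancel)
  have "x \<in> (\<Union>j. (\<lambda>p. p + lattice_point G j) ` P)"
    using assms by (auto simp: basic_cell_def)
  moreover have "j = k" if "x - lattice_point G j \<in> P" "x - lattice_point G k \<in> P" for j k
    using assms that unfolding basic_cell_def disjoint_family_on_def *[symmetric] by blast
  ultimately show ?thesis by (auto simp: *)
qed

lemma cell_quantizer_eqI:
  assumes "basic_cell G P" and P: "lattice_point G j - x \<in> P"
  shows "cell_quantizer G P x = lattice_point G j"
proof -
  have *: "x \<in> (\<lambda>p. - p + y) ` P \<longleftrightarrow> y - x \<in> P" for y
    by (auto simp: image_iff) (metis add.commute diff_add_cancel minus_diff_eq uminus_add_conv_diff)
  show ?thesis
    unfolding cell_quantizer_def *
  proof (rule the_equality)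
    fix y assume "y \<in> range (lattice_point G) \<and> y - x \<in> P"
    then obtain k where k: "y = lattice_point G k" "lattice_point G k - x \<in> P" by auto
    \<comment> \<open>The quantizer uses the reflected cell, so uniqueness is applied at the point
      \<open>- x\<close> with negated indices.\<close>
    have "- x - lattice_point G (- k) \<in> P" "- x - lattice_point G (- j) \<in> P"
      using k P by (simp_all add: lattice_point_minus)
    with basic_cell_ex1[OF assms(1)] have "- k = - j" by blast
    then show "y = lattice_point G j" using k by simp
  qed (use P in auto)
qed

lemma cell_quantizer_mem:
  assumes "basic_cell G P"
  shows "cell_quantizer G P x \<in> range (lattice_point G)" and "cell_quantizer G P x - x \<in> P"
proof -
  obtain j where "- x - lattice_point G j \<in> P"
    using basic_cell_ex1[OF assms] by blast
  then have j: "lattice_point G (- j) - x \<in> P"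
    by (metis lattice_point_minus minus_diff_commute)
  show "cell_quantizer G P x \<in> range (lattice_point G)" "cell_quantizer G P x - x \<in> P"
    using j by (simp_all add: cell_quantizer_eqI[OF assms j])
qed

text \<open>The quantizer takes countably many values, and a preimage is a countable union of
  reflected translates of \<open>P\<close>.\<close>

lemma measurable_cell_quantizer:
  assumes cell: "basic_cell G P" and P [measurable]: "P \<in> sets borel"
  shows "cell_quantizer G P \<in> borel_measurable borel"
proof (rule measurableI)
  fix A :: "(real ^ 'a) set"
  have "cell_quantizer G P -` A = (\<Union>j\<in>{j. lattice_point G j \<in> A}. {x. lattice_point G j - x \<in> P})"
  proof (intro equalityI subsetI)
    fix x assume "x \<in> cell_quantizer G P -` A"
    then show "x \<in> (\<Union>j\<in>{j. lattice_point G j \<in> A}. {x. lattice_point G j - x \<in> P})"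
      using cell_quantizer_mem[OF cell, of x] by auto
  qed (auto simp: cell_quantizer_eqI[OF cell])
  also have "\<dots> \<in> sets borel"
  proof (rule sets.countable_UN'')
    fix j
    have "{x \<in> space borel. lattice_point G j - x \<in> P} \<in> sets borel"
      by measurable
    then show "{x. lattice_point G j - x \<in> P} \<in> sets borel" by simp
  qed (rule countableI_type)
  finally show "cell_quantizer G P -` A \<inter> space borel \<in> sets borel" by simp
qed simp

section \<open>Lebesgue measure, basic cells and subtractive dithering\<close>

lemma lborel_emeasure_translate:
  fixes c :: "'a::euclidean_space"
  assumes [measurable]: "A \<in> sets borel"
  shows "emeasure lborel {x. x + c \<in> A} = emeasure lborel A"
proof -
  have "emeasure lborel A = emeasure (distr lborel borel ((+) c)) A"
    by (simp add: lborel_distr_plus)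
  also have "\<dots> = emeasure lborel {x. x + c \<in> A}"
    by (subst emeasure_distr) (auto simp: vimage_def add.commute)
  finally show ?thesis ..
qed

lemma lborel_emeasure_scale:
  fixes A :: "'a::euclidean_space set"
  assumes [measurable]: "A \<in> sets borel" and "b \<noteq> 0"
  shows "emeasure lborel A = ennreal (\<bar>b\<bar> ^ DIM('a)) * emeasure lborel {x. b *\<^sub>R x \<in> A}"
proof -
  have "emeasure lborel A =
      emeasure (density (distr lborel borel (\<lambda>x. 0 + b *\<^sub>R x)) (\<lambda>_. ennreal (\<bar>b\<bar> ^ DIM('a)))) A"
    using lborel_affine[OF \<open>b \<noteq> 0\<close>, of "0 :: 'a"] by simp
  also have "\<dots> = ennreal (\<bar>b\<bar> ^ DIM('a)) * emeasure lborel {x. b *\<^sub>R x \<in> A}"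
    by (subst emeasure_density_const) (auto simp: emeasure_distr vimage_def)
  finally show ?thesis .
qed

text \<open>Boundedness gives finiteness. A null cell is impossible because countably many
  translates of it cover the space. Hence \<open>uniform_measure lborel P\<close> is a probability
  measure.\<close>

lemma basic_cell_emeasure:
  assumes "basic_cell G P" and [measurable]: "P \<in> sets borel"
  shows "emeasure lborel P \<noteq> 0" and "emeasure lborel P \<noteq> \<infinity>"
proof -
  show "emeasure lborel P \<noteq> \<infinity>"
    using assms(1) emeasure_bounded_finite[of P] by (simp add: basic_cell_def)
  show "emeasure lborel P \<noteq> 0"
  proof
    assume null: "emeasure lborel P = 0"
    have "{x. x + (- lattice_point G j) \<in> P} \<in> null_sets lborel" for j
    proof (rule null_setsI)
      show "emeasure lborel {x. x + (- lattice_point G j) \<in> P} = 0"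
        using lborel_emeasure_translate[of P "- lattice_point G j"] null by simp
      have "{x \<in> space borel. x + (- lattice_point G j) \<in> P} \<in> sets borel" by measurable
      then show "{x. x + (- lattice_point G j) \<in> P} \<in> sets lborel" by simp
    qed
    then have "(\<Union>j. {x. x + (- lattice_point G j) \<in> P}) \<in> null_sets lborel"
      by (intro null_sets_UN') auto
    moreover have "(\<Union>j. {x. x + (- lattice_point G j) \<in> P}) = UNIV"
      using ex1_implies_ex[OF basic_cell_ex1[OF assms(1)]] by auto
    ultimately show False by auto
  qed
qed

text \<open>For every offset \<open>c\<close>, a uniform dither on \<open>P\<close> gives an error
  uniform on \<open>P\<close>. The error map is a translation on each piece of \<open>P\<close> on
  which the quantizer is constant, and the translated pieces again partition \<open>P\<close>. In
  the proof \<open>L j\<close> is the piece of the event with quantizer value \<open>?l j\<close>,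
  and \<open>R j\<close> is its image.\<close>

lemma cell_quantizer_dither_emeasure:
  fixes P :: "(real ^ 'n) set"
  assumes cell: "basic_cell G P" and [measurable]: "P \<in> sets borel" "A \<in> sets borel"
  shows "emeasure lborel (P \<inter> {v. cell_quantizer G P (c - v) + v - c \<in> A}) = emeasure lborel (P \<inter> A)"
proof -
  let ?l = "lattice_point G"
  define L where "L j = {v. v \<in> P \<and> v + (?l j - c) \<in> P \<inter> A}" for j
  define R where "R j = {w. w \<in> P \<inter> A \<and> w - (?l j - c) \<in> P}" for j
  have L [measurable]: "L j \<in> sets borel" for j
  proof -
    have "{v \<in> space borel. v \<in> P \<and> v + (?l j - c) \<in> P \<inter> A} \<in> sets borel" by measurable
    then show ?thesis by (simp add: L_def)
  qed
  have R [measurable]: "R j \<in> sets borel" for j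
  proof -
    have "{v \<in> space borel. v \<in> P \<inter> A \<and> v - (?l j - c) \<in> P} \<in> sets borel" by measurable
    then show ?thesis by (simp add: R_def)
  qed
  have eqL: "P \<inter> {v. cell_quantizer G P (c - v) + v - c \<in> A} = (\<Union>j. L j)"
  proof (intro equalityI subsetI)
    fix v assume v: "v \<in> P \<inter> {v. cell_quantizer G P (c - v) + v - c \<in> A}"
    obtain j where j: "cell_quantizer G P (c - v) = ?l j"
      using cell_quantizer_mem(1)[OF cell] by auto
    with v cell_quantizer_mem(2)[OF cell, of "c - v"] have "v \<in> L j"
      by (simp add: L_def algebra_simps)
    then show "v \<in> (\<Union>j. L j)" by auto
  next
    fix v assume "v \<in> (\<Union>j. L j)"
    then obtain j where j: "v \<in> L j" by auto
    then have "?l j - (c - v) \<in> P" by (simp add: L_def algebra_simps)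
    from cell_quantizer_eqI[OF cell this] j
    show "v \<in> P \<inter> {v. cell_quantizer G P (c - v) + v - c \<in> A}"
      by (simp add: L_def algebra_simps)
  qed
  \<comment> \<open>The piece containing \<open>w\<close> is indexed by the lattice translate of
    \<open>P\<close> that contains \<open>w + c\<close>.\<close>
  have eqR: "P \<inter> A = (\<Union>j. R j)"
    using ex1_implies_ex[OF basic_cell_ex1[OF cell, of "w + c" for w]]
    by (auto simp: R_def algebra_simps)
  have dL: "disjoint_family L"
    unfolding disjoint_family_on_def
  proof (intro ballI impI)
    fix j k :: "int ^ 'n" assume "j \<noteq> k"
    have "j = k" if "v \<in> L j" "v \<in> L k" for v
    proof -
      \<comment> \<open>In \<open>L j\<close> the lattice point is added rather than subtracted, so
        uniqueness concerns the negated indices.\<close>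
      have "(v - c) - ?l (- j) \<in> P" "(v - c) - ?l (- k) \<in> P"
        using that by (simp_all add: L_def lattice_point_minus algebra_simps)
      then have "- j = - k" using basic_cell_ex1[OF cell] by blast
      then show ?thesis by simp
    qed
    then show "L j \<inter> L k = {}" using \<open>j \<noteq> k\<close> by auto
  qed
  have dR: "disjoint_family R"
    unfolding disjoint_family_on_def
  proof (intro ballI impI)
    fix j k :: "int ^ 'n" assume "j \<noteq> k"
    have "j = k" if "w \<in> R j" "w \<in> R k" for w
    proof -
      have "(w + c) - ?l j \<in> P" "(w + c) - ?l k \<in> P"
        using that by (simp_all add: R_def algebra_simps)
      then show ?thesis using basic_cell_ex1[OF cell] by blast
    qed
    then show "R j \<inter> R k = {}" using \<open>j \<noteq> k\<close> by auto
  qed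
  have "L j = {v. v + (?l j - c) \<in> R j}" for j
    by (auto simp: L_def R_def)
  then have "emeasure lborel (L j) = emeasure lborel (R j)" for j
    using lborel_emeasure_translate[OF R] by simp
  then show ?thesis
    unfolding eqL eqR using dL dR
    by (subst (1 2) emeasure_UN_countable) auto
qed

section \<open>Measurability of the quantizer and its error law at a fixed input and layer\<close>

lemma sets_superlevel:
  assumes [measurable]: "f \<in> borel_measurable borel"
  shows "superlevel f t \<in> sets borel"
proof -
  have "{z \<in> space borel. t \<le> f z} \<in> sets borel" by measurable
  then show ?thesis by (simp add: superlevel_def)
qed

text \<open>The accepted index ranges over the countable type \<open>nat\<close>, so selecting the
  dithered quantizer at that index preserves joint measurability in input, layer and dither
  sequence.\<close>

lemma measurable_lrsuq:
  assumes "basic_cell G P" and "P \<in> sets borel"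
    and f [measurable]: "f \<in> borel_measurable borel" and \<beta> [measurable]: "\<beta> \<in> borel_measurable borel"
  shows "(\<lambda>(x, t, v). lrsuq G P f \<beta> x t v)
           \<in> borel_measurable (borel \<Otimes>\<^sub>M borel \<Otimes>\<^sub>M PiM UNIV (\<lambda>_. borel))"
proof -
  note measurable_cell_quantizer[OF assms(1,2), measurable]
  let ?S = "borel \<Otimes>\<^sub>M borel \<Otimes>\<^sub>M PiM UNIV (\<lambda>_. borel)"
  define d where "d i s = dithered_quantizer G P (\<beta> (fst (snd s))) (fst s) (snd (snd s) i)" for i :: nat and s
  have d [measurable]: "d i \<in> borel_measurable ?S" for i
    unfolding d_def[abs_def] dithered_quantizer_def by measurable
  have "(\<lambda>s. LEAST i. fst (snd s) \<le> f (d i s - fst s)) \<in> measurable ?S (count_space UNIV)"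
    by measurable
  from measurable_compose_countable[OF d this] show ?thesis
    by (simp add: lrsuq_def lrsuq_index_def superlevel_def split_beta' d_def)
qed

text \<open>One dithered quantizer gives each measurable subset of the superlevel set a probability
  proportional to its volume. The constant cancels in the rejection-sampling identity, leaving the
  uniform law on the superlevel set, stated as a product to avoid division in
  \<open>ennreal\<close>.\<close>

lemma emeasure_lrsuq_error:
  fixes P :: "(real ^ 'n) set"
  assumes cell: "basic_cell G P" and P [measurable]: "P \<in> sets borel"
    and f [measurable]: "f \<in> borel_measurable borel" and A [measurable]: "A \<in> sets borel"
    and b: "\<beta> t > 0" and sub: "superlevel f t \<subseteq> (\<lambda>p. \<beta> t *\<^sub>R p) ` P"
    and pos: "emeasure lborel (superlevel f t) \<noteq> 0"
  shows "emeasure (PiM UNIV (\<lambda>_. uniform_measure lborel P)) {v. lrsuq G P f \<beta> x t v - x \<in> A}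
           * emeasure lborel (superlevel f t) = emeasure lborel (superlevel f t \<inter> A)"
proof -
  define U where "U = uniform_measure lborel P"
  define D where "D v = dithered_quantizer G P (\<beta> t) x v - x" for v
  define L where "L = superlevel f t"
  define K where "K = emeasure lborel P"
  define s where "s = ennreal (\<beta> t ^ CARD('n))"
  note [measurable] = measurable_cell_quantizer[OF cell P]
  have L [measurable]: "L \<in> sets borel"
    unfolding L_def by (rule sets_superlevel[OF f])
  have D [measurable]: "D \<in> borel_measurable borel"
    unfolding D_def dithered_quantizer_def by measurable
  have K: "K \<noteq> 0" "K \<noteq> \<infinity>"
    using basic_cell_emeasure[OF cell P] by (simp_all add: K_def)
  \<comment> \<open>The constant of proportionality combines the volume \<open>K\<close> of the cell
    with the Jacobian \<open>s\<close> of scaling by \<open>\<beta> t\<close>.\<close>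
  have U: "emeasure U {v. D v \<in> C} * K * s = emeasure lborel C"
    if [measurable]: "C \<in> sets borel" and C: "C \<subseteq> L" for C
  proof -
    have bC [measurable]: "{w. \<beta> t *\<^sub>R w \<in> C} \<in> sets borel"
    proof -
      have "{w \<in> space borel. \<beta> t *\<^sub>R w \<in> C} \<in> sets borel" by measurable
      then show ?thesis by simp
    qed
    have DC: "{v. D v \<in> C} \<in> sets borel"
      using measurable_sets[OF D, of C] by (simp add: vimage_def)
    have D_eq: "D v = \<beta> t *\<^sub>R (cell_quantizer G P (x /\<^sub>R \<beta> t - v) + v - x /\<^sub>R \<beta> t)" for v
      using b by (simp add: D_def dithered_quantizer_def algebra_simps)
    \<comment> \<open>\<open>C\<close> lies inside the scaled cell and scaling by
      \<open>\<beta> t > 0\<close> is injective, so the rescaled set already lies in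
      \<open>P\<close>.\<close>
    have sP: "P \<inter> {w. \<beta> t *\<^sub>R w \<in> C} = {w. \<beta> t *\<^sub>R w \<in> C}"
      using C sub b by (fastforce simp: L_def)
    have "emeasure U {v. D v \<in> C} * K = emeasure lborel (P \<inter> {v. D v \<in> C})"
      using K DC by (simp add: U_def K_def ennreal_divide_times ennreal_divide_self top.not_eq_extremum)
    also have "\<dots> = emeasure lborel {w. \<beta> t *\<^sub>R w \<in> C}"
      using cell_quantizer_dither_emeasure[OF cell P bC, of "x /\<^sub>R \<beta> t"] by (simp add: D_eq sP)
    finally show ?thesis
      using lborel_emeasure_scale[of C "\<beta> t"] b by (simp add: s_def mult.commute)
  qed
  have "prob_space U"
    unfolding U_def by (rule prob_space_uniform_measure) (use K in \<open>simp_all add: K_def\<close>)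
  then interpret sequence_space U
    by (intro sequence_space.intro product_prob_space.intro product_sigma_finite.intro
          product_prob_space_axioms.intro prob_space_imp_sigma_finite)
  have sets_U [measurable_cong]: "sets U = sets borel" by (simp add: U_def)
  have space_S: "space S = UNIV" by (simp add: space_PiM U_def)
  have DL: "{v. D v \<in> C} \<in> sets U" if "C \<in> sets borel" for C
    using measurable_sets[OF D that] by (simp add: vimage_def sets_U)
  have "emeasure U {v. D v \<in> L} \<noteq> 0"
    using U[OF L] pos by (auto simp: L_def)
  \<comment> \<open>Acceptance of the error is read as a condition on the dither: the accepted
    dithers form \<open>{v. D v \<in> L}\<close>.\<close>
  from emeasure_first_accepted[OF DL[OF L] DL[OF A] this]
  have "emeasure S {v. lrsuq G P f \<beta> x t v - x \<in> A} * emeasure U {v. D v \<in> L} =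
      emeasure U ({v. D v \<in> L} \<inter> {v. D v \<in> A})"
    by (simp add: space_S lrsuq_def lrsuq_index_def D_def L_def)
  also have "{v. D v \<in> L} \<inter> {v. D v \<in> A} = {v. D v \<in> L \<inter> A}" by auto
  finally have "emeasure S {v. lrsuq G P f \<beta> x t v - x \<in> A} * (emeasure U {v. D v \<in> L} * K * s) =
      emeasure U {v. D v \<in> L \<inter> A} * K * s"
    by (simp add: mult.assoc[symmetric])
  then show ?thesis
    using U[OF L] U[of "L \<inter> A", OF sets.Int[OF L A]] by (simp add: L_def U_def)
qed

section \<open>The layer-cake formula\<close>

text \<open>Tonelli's theorem on the region \<open>0 < t \<le> f z\<close>: for fixed
  \<open>z\<close> the layers containing it form an interval of length \<open>f z\<close>.\<close>

lemma nn_integral_emeasure_superlevel: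
  fixes f :: "'a::euclidean_space \<Rightarrow> real"
  assumes [measurable]: "f \<in> borel_measurable borel" "A \<in> sets borel" and nonneg: "\<And>z. f z \<ge> 0"
  shows "(\<integral>\<^sup>+t. emeasure lborel (superlevel f t \<inter> A) * indicator {0<..} t \<partial>lborel) =
           (\<integral>\<^sup>+z. ennreal (f z) * indicator A z \<partial>lborel)"
proof -
  have [measurable]: "superlevel f t \<in> sets borel" for t
    by (rule sets_superlevel) fact
  have "emeasure lborel (superlevel f t \<inter> A) * indicator {0<..} t =
      (\<integral>\<^sup>+z. indicator {0<..f z} t * indicator A z \<partial>lborel)" for t
  proof -
    have "emeasure lborel (superlevel f t \<inter> A) * indicator {0<..} t =
        (\<integral>\<^sup>+z. indicator (superlevel f t \<inter> A) z * indicator {0<..} t \<partial>lborel)"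
      by (subst nn_integral_multc) auto
    also have "\<dots> = (\<integral>\<^sup>+z. indicator {0<..f z} t * indicator A z \<partial>lborel)"
      by (intro nn_integral_cong) (auto simp: superlevel_def split: split_indicator)
    finally show ?thesis .
  qed
  then have "(\<integral>\<^sup>+t. emeasure lborel (superlevel f t \<inter> A) * indicator {0<..} t \<partial>lborel) =
      (\<integral>\<^sup>+t. \<integral>\<^sup>+z. indicator {0<..f z} t * indicator A z \<partial>lborel \<partial>lborel)"
    by simp
  also have "\<dots> = (\<integral>\<^sup>+z. \<integral>\<^sup>+t. indicator {0<..f z} t * indicator A z \<partial>lborel \<partial>lborel)"
  proof (rule lborel_pair.Fubini')
    \<comment> \<open>The interval depends on \<open>z\<close>, so its indicator is rewritten as a
      condition on the pair to obtain joint measurability.\<close>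
    have "(\<lambda>p. (if 0 < snd p \<and> snd p \<le> f (fst p) then 1 else 0) * indicator A (fst p) :: ennreal)
      \<in> borel_measurable (lborel \<Otimes>\<^sub>M lborel)"
      by measurable
    then show "(\<lambda>(z, t). indicator {0<..f z} t * indicator A z :: ennreal)
      \<in> borel_measurable (lborel \<Otimes>\<^sub>M lborel)"
      by (simp add: split_beta' indicator_def of_bool_def)
  qed
  also have "\<dots> = (\<integral>\<^sup>+z. ennreal (f z) * indicator A z \<partial>lborel)"
    by (intro nn_integral_cong) (simp add: nn_integral_multc nonneg)
  finally show ?thesis .
qed

section \<open>Product laws from independence\<close>

lemma indep_rv_distr_pair:
  assumes "prob_space M" and indep: "indep_rv M A X B Y"
  shows "distr M (A \<Otimes>\<^sub>M B) (\<lambda>\<omega>. (X \<omega>, Y \<omega>)) = distr M A X \<Otimes>\<^sub>M distr M B Y"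
proof -
  interpret prob_space M by fact
  have X [measurable]: "X \<in> measurable M A" and Y [measurable]: "Y \<in> measurable M B"
    using indep by (simp_all add: indep_rv_def)
  interpret X: prob_space "distr M A X" by (rule prob_space_distr) fact
  interpret Y: prob_space "distr M B Y" by (rule prob_space_distr) fact
  show ?thesis
  proof (rule pair_measure_eqI[symmetric])
    fix E F assume "E \<in> sets (distr M A X)" "F \<in> sets (distr M B Y)"
    then have [measurable]: "E \<in> sets A" "F \<in> sets B" by simp_all
    have "prob ((X -` E \<inter> space M) \<inter> (Y -` F \<inter> space M)) =
        prob (X -` E \<inter> space M) * prob (Y -` F \<inter> space M)"
      using indep by (intro indep_setD) (auto simp: indep_rv_def)
    moreover have "(\<lambda>\<omega>. (X \<omega>, Y \<omega>)) -` (E \<times> F) \<inter> space M =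
        (X -` E \<inter> space M) \<inter> (Y -` F \<inter> space M)"
      by auto
    ultimately show "emeasure (distr M A X) E * emeasure (distr M B Y) F =
        emeasure (distr M (A \<Otimes>\<^sub>M B) (\<lambda>\<omega>. (X \<omega>, Y \<omega>))) (E \<times> F)"
      by (simp add: emeasure_distr emeasure_eq_measure flip: ennreal_mult)
  qed (auto intro: X.sigma_finite_measure Y.sigma_finite_measure)
qed

text \<open>Independence among the dithers makes the law of the whole sequence a product, and
  independence from \<open>T\<close> splits off the layer. This puts the state in the form to which
  the rejection-sampling lemmas apply.\<close>

lemma lrsuq_state_distr:
  assumes "prob_space M" and state: "lrsuq_state M P f T V"
  shows "distr M (borel \<Otimes>\<^sub>M PiM UNIV (\<lambda>_. borel)) (\<lambda>\<omega>. (T \<omega>, \<lambda>i. V i \<omega>)) =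
           distr M borel T \<Otimes>\<^sub>M PiM UNIV (\<lambda>_. uniform_measure lborel P)"
proof -
  interpret prob_space M by fact
  have indep: "indep_vars (\<lambda>_. borel) V UNIV"
    and unif: "\<And>i. distr M lborel (V i) = uniform_measure lborel P"
    and TV: "indep_rv M borel T (PiM UNIV (\<lambda>_. borel)) (\<lambda>\<omega> i. V i \<omega>)"
    using state by (auto simp: lrsuq_state_def)
  have V: "V i \<in> borel_measurable M" for i
    using indep by (auto simp: indep_vars_def)
  have "distr M (PiM UNIV (\<lambda>_. borel)) (\<lambda>\<omega> i. V i \<omega>) = PiM UNIV (\<lambda>i. distr M borel (V i))"
    using indep_vars_iff_distr_eq_PiM[where I = UNIV and M' = "\<lambda>_. borel" and X = V] V indep by (simp add: restrict_UNIV)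
  moreover have "distr M borel (V i) = uniform_measure lborel P" for i
    using unif[of i] by (simp cong: distr_cong)
  ultimately show ?thesis
    using indep_rv_distr_pair[OF assms(1) TV] by simp
qed

section \<open>The joint law of error and input\<close>

text \<open>This product formula carries both the density of the error and its independence of the
  input. The state is integrated out first for a frozen input \<open>x\<close>; the resulting
  probability \<open>I\<close> does not depend on \<open>x\<close>, so it factors out of the
  integral over the input.\<close>

lemma lrsuq_joint_distribution:
  fixes P :: "(real ^ 'n) set"
  assumes cell: "basic_cell G P" and P: "P \<in> sets borel"
    and f [measurable]: "f \<in> borel_measurable borel" and nonneg: "\<And>z. f z \<ge> 0"
    and \<beta> [measurable]: "\<beta> \<in> borel_measurable borel" and \<beta>_nonneg: "\<And>t. t > 0 \<Longrightarrow> \<beta> t \<ge> 0"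
    and sub: "\<And>t. t > 0 \<Longrightarrow> superlevel f t \<subseteq> (\<lambda>p. \<beta> t *\<^sub>R p) ` P"
    and M: "prob_space M" and state: "lrsuq_state M P f T V"
    and XS: "indep_rv M borel X (borel \<Otimes>\<^sub>M PiM UNIV (\<lambda>_. borel)) (\<lambda>\<omega>. (T \<omega>, \<lambda>i. V i \<omega>))"
    and A [measurable]: "A \<in> sets borel" and B [measurable]: "B \<in> sets borel"
  defines "Z \<equiv> \<lambda>\<omega>. lrsuq G P f \<beta> (X \<omega>) (T \<omega>) (\<lambda>i. V i \<omega>) - X \<omega>"
  shows "emeasure M {\<omega> \<in> space M. Z \<omega> \<in> A \<and> X \<omega> \<in> B} =
           emeasure (density lborel (\<lambda>z. ennreal (f z))) A * emeasure (distr M borel X) B"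
proof -
  interpret prob_space M by fact
  define W where "W = PiM (UNIV :: nat set) (\<lambda>_. uniform_measure lborel P)"
  define DT where "DT = distr M borel T"
  define I where "I = emeasure (density lborel (\<lambda>z. ennreal (f z))) A"
  define E where "E = {(x, t, v). lrsuq G P f \<beta> x t v - x \<in> A \<and> x \<in> B}"
  have X [measurable]: "X \<in> borel_measurable M"
    and TV: "(\<lambda>\<omega>. (T \<omega>, \<lambda>i. V i \<omega>)) \<in> measurable M (borel \<Otimes>\<^sub>M PiM UNIV (\<lambda>_. borel))"
    using XS by (simp_all add: indep_rv_def)
  have T [measurable]: "T \<in> borel_measurable M"
    using state by (simp add: lrsuq_state_def indep_rv_def)
  have dT: "distributed M (restrict_space lborel {0<..}) T (\<lambda>t. emeasure lborel (superlevel f t))"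
    using state by (simp add: lrsuq_state_def)
  have sets_W [measurable_cong]: "sets W = sets (PiM UNIV (\<lambda>_. borel))"
    unfolding W_def by (intro sets_PiM_cong) auto
  have space_W: "space W = UNIV"
    by (simp add: W_def space_PiM)
  have sets_DT [measurable_cong]: "sets DT = sets borel" and space_DT: "space DT = UNIV"
    by (simp_all add: DT_def)
  interpret U: prob_space "uniform_measure lborel P"
    by (rule prob_space_uniform_measure) (use basic_cell_emeasure[OF cell P] in auto)
  interpret W: prob_space W
    unfolding W_def by (intro prob_space_PiM U.prob_space_axioms)
  interpret DT: prob_space DT
    unfolding DT_def by (rule prob_space_distr) fact
  interpret TW: pair_prob_space DT W ..
  have q [measurable]: "(\<lambda>p. lrsuq G P f \<beta> (fst p) (fst (snd p)) (snd (snd p)))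
      \<in> borel_measurable (borel \<Otimes>\<^sub>M borel \<Otimes>\<^sub>M PiM UNIV (\<lambda>_. borel))"
    using measurable_lrsuq[OF cell P f \<beta>] by (simp add: split_beta')
  have E [measurable]: "E \<in> sets (borel \<Otimes>\<^sub>M borel \<Otimes>\<^sub>M PiM UNIV (\<lambda>_. borel))"
  proof -
    have "{p \<in> space (borel \<Otimes>\<^sub>M borel \<Otimes>\<^sub>M PiM UNIV (\<lambda>_. borel)).
        lrsuq G P f \<beta> (fst p) (fst (snd p)) (snd (snd p)) - fst p \<in> A \<and> fst p \<in> B}
        \<in> sets (borel \<Otimes>\<^sub>M borel \<Otimes>\<^sub>M PiM UNIV (\<lambda>_. borel))"
      by measurable
    then show ?thesis by (simp add: E_def split_beta' space_pair_measure space_PiM)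
  qed
  have joint: "distr M (borel \<Otimes>\<^sub>M borel \<Otimes>\<^sub>M PiM UNIV (\<lambda>_. borel)) (\<lambda>\<omega>. (X \<omega>, T \<omega>, \<lambda>i. V i \<omega>)) =
      distr M borel X \<Otimes>\<^sub>M (DT \<Otimes>\<^sub>M W)"
    using indep_rv_distr_pair[OF M XS] lrsuq_state_distr[OF M state] by (simp add: DT_def W_def)
  have section_meas: "{(t, v). lrsuq G P f \<beta> x t v - x \<in> A} \<in> sets (DT \<Otimes>\<^sub>M W)" for x
  proof -
    have "(\<lambda>p. lrsuq G P f \<beta> x (fst p) (snd p)) \<in> borel_measurable (borel \<Otimes>\<^sub>M PiM UNIV (\<lambda>_. borel))"
      using measurable_compose[OF measurable_Pair1' q, of x] by simp
    then have "(\<lambda>p. lrsuq G P f \<beta> x (fst p) (snd p)) \<in> borel_measurable (DT \<Otimes>\<^sub>M W)"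
      by (simp cong: measurable_cong_sets add: sets_DT sets_W)
    then have "{p \<in> space (DT \<Otimes>\<^sub>M W). lrsuq G P f \<beta> x (fst p) (snd p) - x \<in> A} \<in> sets (DT \<Otimes>\<^sub>M W)"
      by measurable
    then show ?thesis by (simp add: split_beta' space_pair_measure space_DT space_W)
  qed
  have inner: "emeasure (DT \<Otimes>\<^sub>M W) {(t, v). lrsuq G P f \<beta> x t v - x \<in> A} = I" for x
  proof -
    define e where "e t = emeasure W {v. lrsuq G P f \<beta> x t v - x \<in> A}" for t
    have e [measurable]: "e \<in> borel_measurable borel"
      using W.measurable_emeasure_Pair[OF section_meas[of x]]
      by (simp add: e_def[abs_def] vimage_def cong: measurable_cong_sets add: sets_DT)
    \<comment> \<open>Weighting \<open>e t\<close> by the density of \<open>T\<close> also covers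
      layers of measure zero, where both sides vanish.\<close>
    have e_eq: "emeasure lborel (superlevel f t) * e t = emeasure lborel (superlevel f t \<inter> A)"
      if t: "t > 0" for t
    proof (cases "emeasure lborel (superlevel f t) = 0")
      case True
      moreover from this have "emeasure lborel (superlevel f t \<inter> A) = 0"
        using emeasure_mono[of "superlevel f t \<inter> A" "superlevel f t" lborel]
          sets_superlevel[OF f] by simp
      ultimately show ?thesis by simp
    next
      case False
      \<comment> \<open>A zero scale would confine the superlevel set to the origin, a null
        set.\<close>
      have "\<beta> t \<noteq> 0"
      proof
        assume "\<beta> t = 0"
        then have "superlevel f t \<subseteq> {0}" using sub[OF t] by auto
        then have "emeasure lborel (superlevel f t) \<le> emeasure lborel {0 :: real ^ 'n}"
          by (intro emeasure_mono) auto
        then show False using False by simp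
      qed
      with \<beta>_nonneg[OF t] have "\<beta> t > 0" by simp
      from emeasure_lrsuq_error[where \<beta> = \<beta> and t = t and x = x, OF cell P f A this sub[OF t] False]
      show ?thesis by (simp add: e_def W_def mult.commute)
    qed
    have "emeasure (DT \<Otimes>\<^sub>M W) {(t, v). lrsuq G P f \<beta> x t v - x \<in> A} = (\<integral>\<^sup>+t. e t \<partial>DT)"
      by (subst W.emeasure_pair_measure_alt[OF section_meas]) (simp add: e_def[abs_def] vimage_def)
    also have "\<dots> = (\<integral>\<^sup>+\<omega>. e (T \<omega>) \<partial>M)"
      unfolding DT_def by (subst nn_integral_distr) auto
    \<comment> \<open>The density of \<open>T\<close> supplies exactly the factor by which
      \<open>e_eq\<close> is multiplied.\<close>
    also have "\<dots> = (\<integral>\<^sup>+t. emeasure lborel (superlevel f t) * e t \<partial>restrict_space lborel {0<..})"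
      by (rule distributed_nn_integral[OF dT, symmetric])
         (auto intro: measurable_restrict_space1)
    also have "\<dots> = (\<integral>\<^sup>+t. emeasure lborel (superlevel f t \<inter> A) * indicator {0<..} t \<partial>lborel)"
      by (subst nn_integral_restrict_space)
         (auto intro!: nn_integral_cong simp: e_eq split: split_indicator)
    also have "\<dots> = I"
      unfolding I_def by (simp add: nn_integral_emeasure_superlevel[OF f A nonneg] emeasure_density)
    finally show ?thesis .
  qed
  have "emeasure M {\<omega> \<in> space M. Z \<omega> \<in> A \<and> X \<omega> \<in> B} =
      emeasure (distr M (borel \<Otimes>\<^sub>M borel \<Otimes>\<^sub>M PiM UNIV (\<lambda>_. borel)) (\<lambda>\<omega>. (X \<omega>, T \<omega>, \<lambda>i. V i \<omega>))) E"
    using measurable_Pair[OF X TV] E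
    by (subst emeasure_distr) (auto simp: E_def Z_def intro!: arg_cong2[where f = emeasure])
  also have "\<dots> = (\<integral>\<^sup>+x. emeasure (DT \<Otimes>\<^sub>M W) (Pair x -` E) \<partial>distr M borel X)"
    unfolding joint
  proof (rule TW.emeasure_pair_measure_alt)
    have "sets (distr M borel X \<Otimes>\<^sub>M (DT \<Otimes>\<^sub>M W)) = sets (borel \<Otimes>\<^sub>M borel \<Otimes>\<^sub>M PiM UNIV (\<lambda>_. borel))"
      by (intro sets_pair_measure_cong) (simp_all add: sets_DT sets_W)
    then show "E \<in> sets (distr M borel X \<Otimes>\<^sub>M (DT \<Otimes>\<^sub>M W))" using E by simp
  qed
  also have "\<dots> = (\<integral>\<^sup>+x. I * indicator B x \<partial>distr M borel X)"
  proof (rule nn_integral_cong)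
    fix x
    have "Pair x -` E = (if x \<in> B then {(t, v). lrsuq G P f \<beta> x t v - x \<in> A} else {})"
      by (auto simp: E_def)
    then show "emeasure (DT \<Otimes>\<^sub>M W) (Pair x -` E) = I * indicator B x"
      using inner[of x] by simp
  qed
  also have "\<dots> = I * emeasure (distr M borel X) B"
    by (subst nn_integral_cmult) auto
  finally show ?thesis by (simp add: I_def)
qed

section \<open>Density of the error and independence from the joint law\<close>

theorem proposition13:
  fixes G :: "real ^ 'n ^ 'n"
    and P :: "(real ^ 'n) set"
    and f :: "real ^ 'n \<Rightarrow> real"
    and \<beta> :: "real \<Rightarrow> real"
    and M :: "'w measure"
    and X :: "'w \<Rightarrow> real ^ 'n"
    and T :: "'w \<Rightarrow> real"
    and V :: "nat \<Rightarrow> 'w \<Rightarrow> real ^ 'n"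
  assumes "rank G = CARD('n)"
    and "basic_cell G P" and "P \<in> sets borel"
    and "f \<in> borel_measurable borel" and "\<And>z. f z \<ge> 0"
    and "(\<integral>\<^sup>+ z. ennreal (f z) \<partial>lborel) = 1"
    and "\<And>t. t > 0 \<Longrightarrow> bounded (superlevel f t)"
    and "\<beta> \<in> borel_measurable (restrict_space borel {0<..})"
    and "\<And>t. t > 0 \<Longrightarrow> \<beta> t \<ge> 0"
    and "\<And>t. t > 0 \<Longrightarrow> superlevel f t \<subseteq> (\<lambda>p. \<beta> t *\<^sub>R p) ` P"
    and "prob_space M"
    and "lrsuq_state M P f T V"
    and "indep_rv M borel X (borel \<Otimes>\<^sub>M PiM UNIV (\<lambda>_. borel)) (\<lambda>\<omega>. (T \<omega>, \<lambda>i. V i \<omega>))"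
  shows "let Z = (\<lambda>\<omega>. lrsuq G P f \<beta> (X \<omega>) (T \<omega>) (\<lambda>i. V i \<omega>) - X \<omega>) in
           distributed M lborel Z (\<lambda>z. ennreal (f z)) \<and>
           prob_space.indep_var M borel Z borel X"
proof -
  interpret prob_space M by fact
  \<comment> \<open>\<open>\<beta>\<close> is only measurable on \<open>(0,\<infinity>)\<close>; since \<open>T > 0\<close> it may be replaced by \<open>\<gamma>\<close>.\<close>
  define \<gamma> where "\<gamma> t = (if t \<in> {0<..} then \<beta> t else 0)" for t
  define Z where "Z = (\<lambda>\<omega>. lrsuq G P f \<beta> (X \<omega>) (T \<omega>) (\<lambda>i. V i \<omega>) - X \<omega>)"
  define Y where "Y = (\<lambda>\<omega>. lrsuq G P f \<gamma> (X \<omega>) (T \<omega>) (\<lambda>i. V i \<omega>) - X \<omega>)"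
  have \<gamma>: "\<gamma> \<in> borel_measurable borel"
    unfolding \<gamma>_def using assms(8) by (subst measurable_If_restrict_space_iff) (auto simp: greaterThan_def)
  have \<gamma>_eq: "\<gamma> t = \<beta> t" if "t > 0" for t
    using that by (simp add: \<gamma>_def)
  have T: "T \<in> measurable M (restrict_space lborel {0<..})"
    using assms(12) by (simp add: lrsuq_state_def distributed_def)
  \<comment> \<open>Positivity holds at every point of the space, not just almost surely, because
    \<open>T\<close> is measurable into the restricted space. Hence \<open>Z\<close> and
    \<open>Y\<close> agree pointwise.\<close>
  have "T \<omega> > 0" if "\<omega> \<in> space M" for \<omega>
    using measurable_space[OF T that] by (simp add: space_restrict_space)
  then have ZY: "Z \<omega> = Y \<omega>" if "\<omega> \<in> space M" for \<omega>
    using that by (simp add: Z_def Y_def lrsuq_def lrsuq_index_def \<gamma>_eq)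
  have X [measurable]: "X \<in> borel_measurable M"
    and TV: "(\<lambda>\<omega>. (T \<omega>, \<lambda>i. V i \<omega>)) \<in> measurable M (borel \<Otimes>\<^sub>M PiM UNIV (\<lambda>_. borel))"
    using assms(13) by (simp_all add: indep_rv_def)
  have "(\<lambda>\<omega>. lrsuq G P f \<gamma> (X \<omega>) (T \<omega>) (\<lambda>i. V i \<omega>)) \<in> borel_measurable M"
    using measurable_compose[OF measurable_Pair[OF X TV] measurable_lrsuq[OF assms(2-4) \<gamma>]] by simp
  then have "Y \<in> borel_measurable M"
    unfolding Y_def by measurable
  then have Z [measurable]: "Z \<in> borel_measurable M"
    by (simp add: ZY cong: measurable_cong)
  have joint: "emeasure M {\<omega> \<in> space M. Z \<omega> \<in> A \<and> X \<omega> \<in> B} =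
      emeasure (density lborel (\<lambda>z. ennreal (f z))) A * emeasure (distr M borel X) B"
    if AB: "A \<in> sets borel" "B \<in> sets borel" for A B
  proof -
    have nonneg: "\<gamma> t \<ge> 0" and sub: "superlevel f t \<subseteq> (\<lambda>p. \<gamma> t *\<^sub>R p) ` P" if "t > 0" for t
      using assms(9,10)[OF that] \<gamma>_eq[OF that] by simp_all
    have "{\<omega> \<in> space M. Z \<omega> \<in> A \<and> X \<omega> \<in> B} = {\<omega> \<in> space M. Y \<omega> \<in> A \<and> X \<omega> \<in> B}"
      using ZY by auto
    then show ?thesis
      using lrsuq_joint_distribution[where \<beta> = \<gamma> and P = P,
          OF assms(2-5) \<gamma> nonneg sub assms(11-13) AB]
      by (simp add: Y_def)
  qed
  have distr_X: "emeasure (distr M borel X) UNIV = 1"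
    using emeasure_space_1 by (simp add: emeasure_distr)
  \<comment> \<open>The marginal law is the case \<open>B = UNIV\<close> of
    \<open>joint\<close>.\<close>
  have distr_Z: "distr M lborel Z = density lborel (\<lambda>z. ennreal (f z))"
  proof (rule measure_eqI)
    fix A assume "A \<in> sets (distr M lborel Z)"
    then have A: "A \<in> sets borel" by simp
    then have "emeasure (distr M lborel Z) A = emeasure M {\<omega> \<in> space M. Z \<omega> \<in> A}"
      by (subst emeasure_distr) (auto intro!: arg_cong2[where f = emeasure])
    then show "emeasure (distr M lborel Z) A = emeasure (density lborel (\<lambda>z. ennreal (f z))) A"
      using joint[OF A, of UNIV] distr_X by simp
  qed simp
  have "distributed M lborel Z (\<lambda>z. ennreal (f z))"
    using distr_Z assms(4) by (simp add: distributed_def)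
  moreover have "indep_var borel Z borel X"
    unfolding indep_rv_iff_indep_var[OF assms(11), symmetric] indep_rv_def indep_sets2_eq
  proof (intro conjI ballI)
    fix a b
    assume "a \<in> {Z -` E \<inter> space M |E. E \<in> sets borel}" "b \<in> {X -` E \<inter> space M |E. E \<in> sets borel}"
    then obtain A B where AB [measurable]: "A \<in> sets borel" "B \<in> sets borel"
      and ab: "a = Z -` A \<inter> space M" "b = X -` B \<inter> space M" by blast
    have "emeasure M (a \<inter> b) = emeasure M {\<omega> \<in> space M. Z \<omega> \<in> A \<and> X \<omega> \<in> B}"
      unfolding ab by (intro arg_cong2[where f = emeasure]) auto
    \<comment> \<open>Rewriting the density back as the law of \<open>Z\<close> turns
      \<open>joint\<close> into the product rule for the two preimages.\<close>
    also have "\<dots> = emeasure M a * emeasure M b"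
      unfolding joint[OF AB] distr_Z[symmetric] ab by (simp add: emeasure_distr)
    finally show "prob (a \<inter> b) = prob a * prob b"
      by (simp add: emeasure_eq_measure flip: ennreal_mult)
  qed auto
  ultimately show ?thesis
    unfolding Z_def by (simp add: Let_def)
qed

end
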